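(* In an augmented virtual double category let $h\colon C\to E$ be a vertical morphism and $J\colon C\nrightarrow C$ a horizontal morphism. Let $\chi\colon J\Rightarrow(E)$ be a cell with vertical source and vertical target both equal to $h$, and let $\psi\colon J\Rightarrow(C)$ be a horizontal cell, such that $\chi=\mathrm{id}_h\circ\psi$. Any two of the following properties imply the third: (a) the cell $\chi$ is cartesian (defining $J$ as the nullary restriction $E(h,h)$); (b) the cell $\psi$ is cartesian (defining $J$ as the horizontal unit of $C$); (c) the morphism $h$ is full and faithful. Moreover, if (a) holds then (b) is equivalent to: (b') the factorisation $\mathrm{id}'$ of $\mathrm{id}_h$ through $\chi$, that is the unique horizontal cell $\mathrm{id}'\colon(C)\Rightarrow J$ such that $\mathrm{id}_h=\chi\circ\mathrm{id}'$, is cartesian. Consequently any full and faithful morphism $h\colon C\to E$ in an augmented virtual equipment reflects unitality: if the target $E$ is unital then so is the source $C$.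
   Context: **Augmented virtual double categories.** An augmented virtual double category $\mathcal K$ consists of: a class of objects; a category $\mathcal K_{\mathrm v}$ with these objects, whose morphisms $f\colon A\to C$ are called vertical; a directed graph $\mathcal K_{\mathrm h}$ with these objects as vertices, whose edges $J\colon A\nrightarrow B$ are called horizontal morphisms; and a class of cells. Each cell $\phi$ has a horizontal source, which is a (possibly empty) path $\underline J=(J_1,\dots,J_n)\colon A_0\nrightarrow A_n$ of horizontal morphisms; a horizontal target, which is a path $\underline K\colon C\nrightarrow D$ of length $|\underline K|\le 1$; a vertical source $f\colon A_0\to C$; and a vertical target $g\colon A_n\to D$. We write $\phi\colon\underline J\Rightarrow\underline K$. The empty path at $A$ is written $(A)$ (so $\underline K=(C)$ forces $C=D$), and $\frown$ denotes concatenation of paths. For each $n\ge 1$, each path of cells $\phi_i\colon\underline J_i\Rightarrow\underline K_i$ ($1\le i\le n$) with vertical source $f_{i-1}$ and vertical target $f_i$, and each cell $\psi\colon\underline K_1\frown\dots\frown\underline K_n\Rightarrow\underline L$ with vertical source $h$ and target $k$, there is a vertical composite $\psi\circ(\phi_1,\dots,\phi_n)\colon\underline J_1\frown\dots\frown\underline J_n\Rightarrow\underline L$ with vertical source $h\circ f_0$ and target $k\circ f_n$. There are horizontal identity cells $\mathrm{id}_J\colon J\Rightarrow J$ (with identities as vertical source and target) and vertical identity cells $\mathrm{id}_f\colon (A)\Rightarrow(C)$ for $f\colon A\to C$ (with vertical source and target $f$), with $\mathrm{id}_h\circ(\mathrm{id}_f)=\mathrm{id}_{h\circ f}$; write $\mathrm{id}_A:=\mathrm{id}_{\mathrm{id}_A}$.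 Axioms, whenever they make sense (for associativity: whenever both sides make sense): $\chi\circ(\psi_1\circ(\phi_{11},\dots,\phi_{1m_1}),\dots,\psi_n\circ(\phi_{n1},\dots,\phi_{nm_n}))=(\chi\circ(\psi_1,\dots,\psi_n))\circ(\phi_{11},\dots,\phi_{nm_n})$; $\mathrm{id}_C\circ(\phi)=\phi$; $\mathrm{id}_K\circ(\phi)=\phi$; $\phi\circ(\mathrm{id}_A)=\phi$; $\phi\circ(\mathrm{id}_{J_1},\dots,\mathrm{id}_{J_n})=\phi$; and $\psi\circ(\phi_1,\dots,\phi_i,\mathrm{id}_{f_i},\phi_{i+1},\dots,\phi_n)=\psi\circ(\phi_1,\dots,\phi_n)$ for $0\le i\le n$. A cell is horizontal if its vertical source and target are identities. **Cartesian cells and restrictions.** A cell $\psi\colon\underline J\Rightarrow\underline K$ with $|\underline J|\le1$, $\underline J\colon A\nrightarrow B$, vertical source $f\colon A\to C$ and target $g\colon B\to D$, is cartesian if every cell $\chi\colon\underline H\Rightarrow\underline K$, with $\underline H\colon X_0\nrightarrow X_n$ and with vertical source $f\circ h$ and target $g\circ k$ (for any $h\colon X_0\to A$, $k\colon X_n\to B$), factors as $\chi=\psi\circ\phi$ for a unique $\phi\colon\underline H\Rightarrow\underline J$ with vertical source $h$ and target $k$. If $|\underline J|=1$, its horizontal source $J$ is called the restriction $\underline K(f,g)$ of $\underline K$ along $f$ and $g$; it is unary if $|\underline K|=1$, and nullary, denoted $C(f,g)$, if $\underline K=(C)$. The horizontal unit of $C$ is $I_C:=C(\mathrm{id}_C,\mathrm{id}_C)$;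 $C$ is unital if $I_C$ exists. A vertical morphism $f$ is full and faithful if the vertical identity cell $\mathrm{id}_f$ is cartesian. An augmented virtual equipment is an augmented virtual double category that has all unary restrictions $K(f,g)$. *)

theory Defs
  imports Main
begin

text \<open>
  A path of horizontal morphisms is a pair of its starting object and its list of edges, so that
  the empty path at \<open>A\<close> is \<open>(A, [])\<close> and empty paths at different objects are different.
\<close>

type_synonym ('o, 'h) hpath = "'o \<times> 'h list"

record ('o, 'v, 'h, 'c) avdc_data =
  Ob :: "'o set"
  Vert :: "'v set"
  vdom :: "'v \<Rightarrow> 'o"
  vcod :: "'v \<Rightarrow> 'o"
  vid :: "'o \<Rightarrow> 'v"
  vcomp :: "'v \<Rightarrow> 'v \<Rightarrow> 'v"
  Hor :: "'h set"
  hdom :: "'h \<Rightarrow> 'o"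
  hcod :: "'h \<Rightarrow> 'o"
  Cell :: "'c set"
  hsource :: "'c \<Rightarrow> ('o, 'h) hpath"
  htarget :: "'c \<Rightarrow> ('o, 'h) hpath"
  vsource :: "'c \<Rightarrow> 'v"
  vtarget :: "'c \<Rightarrow> 'v"
  ccomp :: "'c \<Rightarrow> 'c list \<Rightarrow> 'c"
  hid_cell :: "'h \<Rightarrow> 'c"
  vid_cell :: "'v \<Rightarrow> 'c"

definition is_vert :: "('o, 'v, 'h, 'c) avdc_data \<Rightarrow> 'v \<Rightarrow> 'o \<Rightarrow> 'o \<Rightarrow> bool" where
  "is_vert K f A C \<longleftrightarrow> f \<in> Vert K \<and> vdom K f = A \<and> vcod K f = C"

definition is_hor :: "('o, 'v, 'h, 'c) avdc_data \<Rightarrow> 'h \<Rightarrow> 'o \<Rightarrow> 'o \<Rightarrow> bool" where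
  "is_hor K J A B \<longleftrightarrow> J \<in> Hor K \<and> hdom K J = A \<and> hcod K J = B"

primrec is_walk :: "('o, 'v, 'h, 'c) avdc_data \<Rightarrow> 'o \<Rightarrow> 'h list \<Rightarrow> 'o \<Rightarrow> bool" where
  "is_walk K A [] B \<longleftrightarrow> A \<in> Ob K \<and> B = A"
| "is_walk K A (J # Js) B \<longleftrightarrow> J \<in> Hor K \<and> hdom K J = A \<and> is_walk K (hcod K J) Js B"

definition is_path :: "('o, 'v, 'h, 'c) avdc_data \<Rightarrow> ('o, 'h) hpath \<Rightarrow> 'o \<Rightarrow> 'o \<Rightarrow> bool" where
  "is_path K P A B \<longleftrightarrow> fst P = A \<and> is_walk K A (snd P) B"

abbreviation path_length :: "('o, 'h) hpath \<Rightarrow> nat" where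
  "path_length P \<equiv> length (snd P)"

text \<open>Concatenation of a nonempty list of consecutive paths.\<close>

definition path_concat :: "('o, 'h) hpath list \<Rightarrow> ('o, 'h) hpath" where
  "path_concat Ps = (fst (hd Ps), concat (map snd Ps))"

text \<open>\<open>is_cell K \<phi> f P Q g\<close>: \<open>\<phi>\<close> is a cell \<open>P \<Rightarrow> Q\<close> with vertical source \<open>f\<close> and vertical target \<open>g\<close>.\<close>

definition is_cell ::
  "('o, 'v, 'h, 'c) avdc_data \<Rightarrow> 'c \<Rightarrow> 'v \<Rightarrow> ('o, 'h) hpath \<Rightarrow> ('o, 'h) hpath \<Rightarrow> 'v \<Rightarrow> bool" where
  "is_cell K \<phi> f P Q g \<longleftrightarrow>
     \<phi> \<in> Cell K \<and> vsource K \<phi> = f \<and> hsource K \<phi> = P \<and> htarget K \<phi> = Q \<and> vtarget K \<phi> = g"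

text \<open>
  The condition for the composite \<open>\<psi> \<circ> (\<phi>\<^sub>1, \<dots>, \<phi>\<^sub>n)\<close>, with \<open>n \<ge> 1\<close>, to be defined.  Outside
  this condition the value of \<^const>\<open>ccomp\<close> is irrelevant.
\<close>

definition composable :: "('o, 'v, 'h, 'c) avdc_data \<Rightarrow> 'c \<Rightarrow> 'c list \<Rightarrow> bool" where
  "composable K \<psi> \<phi>s \<longleftrightarrow>
     \<psi> \<in> Cell K \<and> \<phi>s \<noteq> [] \<and> set \<phi>s \<subseteq> Cell K \<and>
     (\<forall>i. Suc i < length \<phi>s \<longrightarrow> vtarget K (\<phi>s ! i) = vsource K (\<phi>s ! Suc i)) \<and>
     hsource K \<psi> = path_concat (map (htarget K) \<phi>s)"

locale augmented_virtual_double_category =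
  fixes K :: "('o, 'v, 'h, 'c) avdc_data"
  assumes vert_ob: "f \<in> Vert K \<Longrightarrow> vdom K f \<in> Ob K \<and> vcod K f \<in> Ob K"
    and vid_vert: "A \<in> Ob K \<Longrightarrow> is_vert K (vid K A) A A"
    and vcomp_vert: "is_vert K f A B \<Longrightarrow> is_vert K g B C \<Longrightarrow> is_vert K (vcomp K g f) A C"
    and vcomp_vid_right: "is_vert K f A B \<Longrightarrow> vcomp K f (vid K A) = f"
    and vcomp_vid_left: "is_vert K f A B \<Longrightarrow> vcomp K (vid K B) f = f"
    and vcomp_assoc: "is_vert K f A B \<Longrightarrow> is_vert K g B C \<Longrightarrow> is_vert K h C D \<Longrightarrow>
      vcomp K h (vcomp K g f) = vcomp K (vcomp K h g) f"
    and hor_ob: "J \<in> Hor K \<Longrightarrow> hdom K J \<in> Ob K \<and> hcod K J \<in> Ob K"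
    and cell_vert: "\<phi> \<in> Cell K \<Longrightarrow> vsource K \<phi> \<in> Vert K \<and> vtarget K \<phi> \<in> Vert K"
    and cell_hsource: "\<phi> \<in> Cell K \<Longrightarrow>
      is_path K (hsource K \<phi>) (vdom K (vsource K \<phi>)) (vdom K (vtarget K \<phi>))"
    and cell_htarget: "\<phi> \<in> Cell K \<Longrightarrow>
      is_path K (htarget K \<phi>) (vcod K (vsource K \<phi>)) (vcod K (vtarget K \<phi>))"
    and cell_htarget_length: "\<phi> \<in> Cell K \<Longrightarrow> path_length (htarget K \<phi>) \<le> 1"
    and ccomp_cell: "composable K \<psi> \<phi>s \<Longrightarrow>
      is_cell K (ccomp K \<psi> \<phi>s)
        (vcomp K (vsource K \<psi>) (vsource K (hd \<phi>s)))
        (path_concat (map (hsource K) \<phi>s)) (htarget K \<psi>)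
        (vcomp K (vtarget K \<psi>) (vtarget K (last \<phi>s)))"
    and hid_cell: "is_hor K J A B \<Longrightarrow>
      is_cell K (hid_cell K J) (vid K A) (A, [J]) (A, [J]) (vid K B)"
    and vid_cell: "is_vert K f A C \<Longrightarrow> is_cell K (vid_cell K f) f (A, []) (C, []) f"
    and vid_cell_comp: "is_vert K f A B \<Longrightarrow> is_vert K h B C \<Longrightarrow>
      ccomp K (vid_cell K h) [vid_cell K f] = vid_cell K (vcomp K h f)"
    and ccomp_assoc: "length \<phi>ss = length \<psi>s \<Longrightarrow>
      (\<And>i. i < length \<psi>s \<Longrightarrow> composable K (\<psi>s ! i) (\<phi>ss ! i)) \<Longrightarrow>
      composable K \<chi> (map2 (ccomp K) \<psi>s \<phi>ss) \<Longrightarrow>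
      composable K \<chi> \<psi>s \<Longrightarrow>
      composable K (ccomp K \<chi> \<psi>s) (concat \<phi>ss) \<Longrightarrow>
      ccomp K \<chi> (map2 (ccomp K) \<psi>s \<phi>ss) = ccomp K (ccomp K \<chi> \<psi>s) (concat \<phi>ss)"
    and ccomp_unit_empty_target: "\<phi> \<in> Cell K \<Longrightarrow> htarget K \<phi> = (C, []) \<Longrightarrow>
      ccomp K (vid_cell K (vid K C)) [\<phi>] = \<phi>"
    and ccomp_unit_target: "\<phi> \<in> Cell K \<Longrightarrow> htarget K \<phi> = (C, [H]) \<Longrightarrow>
      ccomp K (hid_cell K H) [\<phi>] = \<phi>"
    and ccomp_unit_empty_source: "\<phi> \<in> Cell K \<Longrightarrow> hsource K \<phi> = (A, []) \<Longrightarrow>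
      ccomp K \<phi> [vid_cell K (vid K A)] = \<phi>"
    and ccomp_unit_source: "\<phi> \<in> Cell K \<Longrightarrow> hsource K \<phi> = (A, Js) \<Longrightarrow> Js \<noteq> [] \<Longrightarrow>
      ccomp K \<phi> (map (hid_cell K) Js) = \<phi>"
    \<comment> \<open>Composability of the list on the left determines \<open>f\<close>.\<close>
    and ccomp_insert_vid_cell: "f \<in> Vert K \<Longrightarrow> composable K \<psi> (\<phi>s @ \<phi>s') \<Longrightarrow>
      composable K \<psi> (\<phi>s @ [vid_cell K f] @ \<phi>s') \<Longrightarrow>
      ccomp K \<psi> (\<phi>s @ [vid_cell K f] @ \<phi>s') = ccomp K \<psi> (\<phi>s @ \<phi>s')"

definition cartesian :: "('o, 'v, 'h, 'c) avdc_data \<Rightarrow> 'c \<Rightarrow> bool" where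
  "cartesian K \<psi> \<longleftrightarrow>
     \<psi> \<in> Cell K \<and> path_length (hsource K \<psi>) \<le> 1 \<and>
     (\<forall>\<chi> P X Y h k.
        is_vert K h X (vdom K (vsource K \<psi>)) \<and> is_vert K k Y (vdom K (vtarget K \<psi>)) \<and>
        is_path K P X Y \<and>
        is_cell K \<chi> (vcomp K (vsource K \<psi>) h) P (htarget K \<psi>) (vcomp K (vtarget K \<psi>) k) \<longrightarrow>
        (\<exists>!\<phi>. is_cell K \<phi> h P (hsource K \<psi>) k \<and> \<chi> = ccomp K \<psi> [\<phi>]))"

text \<open>\<open>is_restriction K Q f g J\<close>: the horizontal morphism \<open>J\<close> is a restriction \<open>Q(f, g)\<close> of the path \<open>Q\<close>.\<close>

definition is_restriction ::
  "('o, 'v, 'h, 'c) avdc_data \<Rightarrow> ('o, 'h) hpath \<Rightarrow> 'v \<Rightarrow> 'v \<Rightarrow> 'h \<Rightarrow> bool" where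
  "is_restriction K Q f g J \<longleftrightarrow>
     (\<exists>\<psi>. is_cell K \<psi> f (vdom K f, [J]) Q g \<and> cartesian K \<psi>)"

definition is_horizontal_unit :: "('o, 'v, 'h, 'c) avdc_data \<Rightarrow> 'o \<Rightarrow> 'h \<Rightarrow> bool" where
  "is_horizontal_unit K C I \<longleftrightarrow> is_restriction K (C, []) (vid K C) (vid K C) I"

definition unital :: "('o, 'v, 'h, 'c) avdc_data \<Rightarrow> 'o \<Rightarrow> bool" where
  "unital K C \<longleftrightarrow> C \<in> Ob K \<and> (\<exists>I. is_horizontal_unit K C I)"

definition full_and_faithful :: "('o, 'v, 'h, 'c) avdc_data \<Rightarrow> 'v \<Rightarrow> bool" where
  "full_and_faithful K f \<longleftrightarrow> f \<in> Vert K \<and> cartesian K (vid_cell K f)"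

locale augmented_virtual_equipment = augmented_virtual_double_category +
  assumes unary_restrictions:
    "is_hor K H C D \<Longrightarrow> is_vert K f A C \<Longrightarrow> is_vert K g B D \<Longrightarrow>
      \<exists>J. is_restriction K (C, [H]) f g J"

end

theory Submission
  imports Defs
begin

text \<open>
  The factor \<open>\<rho>\<close> of a composite \<open>\<rho> \<circ> \<psi>\<close> is cancellable: if \<open>\<rho>\<close> is cartesian then \<open>\<rho> \<circ> \<psi>\<close> is
  cartesian if and only if \<open>\<psi>\<close> is, and if \<open>\<psi>\<close> is cartesian with identities as vertical source and
  target then so is \<open>\<rho>\<close> whenever \<open>\<rho> \<circ> \<psi>\<close> is.  Applied to \<open>\<chi> = id\<^sub>h \<circ> \<psi>\<close> this gives the implications
  between (a), (b) and (c); applied to \<open>id\<^sub>h = \<chi> \<circ> id'\<close> it identifies (b') with (c).  For the last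
  claim, restrict the unit of \<open>E\<close> along \<open>h\<close> and factor the resulting nullary restriction
  \<open>E(h, h)\<close> through the cartesian cell \<open>id\<^sub>h\<close>.
\<close>

context augmented_virtual_double_category
begin

lemma is_cell_vert:
  assumes "is_cell K \<phi> f P Q g"
  shows "is_vert K f (vdom K f) (vcod K f)" "is_vert K g (vdom K g) (vcod K g)"
  using assms cell_vert[of \<phi>] by (auto simp: is_cell_def is_vert_def)

lemma is_cell_path:
  assumes "is_cell K \<phi> f P Q g"
  shows "is_path K P (vdom K f) (vdom K g)" "is_path K Q (vcod K f) (vcod K g)"
  using assms cell_hsource[of \<phi>] cell_htarget[of \<phi>] by (auto simp: is_cell_def)

lemma path_ends_unique:
  assumes "is_path K P A B" "is_path K P A' B'"
  shows "A = A'" "B = B'"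
proof -
  have "is_walk K A Js B \<Longrightarrow> is_walk K A Js B' \<Longrightarrow> B = B'" for A Js B B'
    by (induction Js arbitrary: A) auto
  then show "A = A'" "B = B'"
    using assms by (auto simp: is_path_def)
qed

lemma composable_single:
  assumes "is_cell K \<phi> f P Q g" "is_cell K \<psi> f' Q R g'"
  shows "composable K \<psi> [\<phi>]"
  using assms by (auto simp: composable_def is_cell_def path_concat_def)

lemma is_cell_ccomp:
  assumes "is_cell K \<phi> f P Q g" "is_cell K \<psi> f' Q R g'"
  shows "is_cell K (ccomp K \<psi> [\<phi>]) (vcomp K f' f) P R (vcomp K g' g)"
  using ccomp_cell[OF composable_single[OF assms]] assms
  by (auto simp: is_cell_def path_concat_def)

lemma ccomp_single_assoc:
  assumes "is_cell K \<phi> f P Q g" "is_cell K \<psi> f' Q R g'" "is_cell K \<chi> f'' R S g''"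
  shows "ccomp K \<chi> [ccomp K \<psi> [\<phi>]] = ccomp K (ccomp K \<chi> [\<psi>]) [\<phi>]"
proof -
  have "composable K \<chi> [ccomp K \<psi> [\<phi>]]" "composable K (ccomp K \<chi> [\<psi>]) [\<phi>]"
    using composable_single is_cell_ccomp assms by blast+
  then show ?thesis
    using ccomp_assoc[of "[[\<phi>]]" "[\<psi>]" \<chi>] assms composable_single by auto
qed

text \<open>Both cells touch the path \<open>Q\<close>, and a path determines its end objects. This
  is what makes the vertical sides of the two cells composable.\<close>

lemma vcod_eq_vdom:
  assumes "is_cell K \<phi> f P Q g" "is_cell K \<psi> f' Q R g'"
  shows "vcod K f = vdom K f'" "vcod K g = vdom K g'"
  using is_cell_path(2)[OF assms(1)] is_cell_path(1)[OF assms(2)] path_ends_unique by blast+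

text \<open>Working form of the universal property: \<open>X\<close> and \<open>Y\<close> can only
  be the domains of \<open>h\<close> and \<open>k\<close>, and the typing of \<open>\<chi>\<close>
  supplies the path condition, leaving only vertical morphisms and test cells to quantify
  over.\<close>

lemma cartesian_iff:
  assumes "is_cell K \<psi> f P Q g"
  shows "cartesian K \<psi> \<longleftrightarrow> path_length P \<le> 1 \<and>
    (\<forall>\<chi> H h k. is_vert K h (vdom K h) (vdom K f) \<and> is_vert K k (vdom K k) (vdom K g) \<and>
      is_cell K \<chi> (vcomp K f h) H Q (vcomp K g k) \<longrightarrow>
      (\<exists>!\<phi>. is_cell K \<phi> h H P k \<and> \<chi> = ccomp K \<psi> [\<phi>]))"
proof -
  note fg = is_cell_vert[OF assms]
  have \<psi>: "\<psi> \<in> Cell K \<longleftrightarrow> True" "vsource K \<psi> = f" "hsource K \<psi> = P" "htarget K \<psi> = Q" "vtarget K \<psi> = g"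
    using assms by (auto simp: is_cell_def)
  \<comment> \<open>Exposes \<open>X = vdom K h\<close> as an equation, so that the simplifier can
    later eliminate the quantifiers over \<open>X\<close> and \<open>Y\<close>.\<close>
  have ends: "is_vert K h X A \<longleftrightarrow> is_vert K h (vdom K h) A \<and> X = vdom K h" for h X A
    by (auto simp: is_vert_def)
  have "is_path K H (vdom K h) (vdom K k)"
    if "is_vert K h (vdom K h) (vdom K f)" "is_vert K k (vdom K k) (vdom K g)"
      "is_cell K \<chi> (vcomp K f h) H Q (vcomp K g k)" for \<chi> H h k
    using is_cell_path(1)[OF that(3)] vcomp_vert[OF that(1) fg(1)] vcomp_vert[OF that(2) fg(2)]
    by (simp add: is_vert_def)
  then have "(is_vert K h X (vdom K f) \<and> is_vert K k Y (vdom K g) \<and> is_path K H X Y \<and>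
        is_cell K \<chi> (vcomp K f h) H Q (vcomp K g k)) \<longleftrightarrow>
      X = vdom K h \<and> Y = vdom K k \<and>
      is_vert K h (vdom K h) (vdom K f) \<and> is_vert K k (vdom K k) (vdom K g) \<and>
      is_cell K \<chi> (vcomp K f h) H Q (vcomp K g k)" for \<chi> H h k X Y
    using ends[of h X] ends[of k Y] by metis
  then show ?thesis
    unfolding cartesian_def \<psi> by simp
qed

lemma cartesian_factor:
  assumes "cartesian K \<psi>" "is_cell K \<psi> f P Q g"
    and "is_vert K h X (vdom K f)" "is_vert K k Y (vdom K g)"
    and "is_cell K \<chi> (vcomp K f h) H Q (vcomp K g k)"
  shows "\<exists>!\<phi>. is_cell K \<phi> h H P k \<and> \<chi> = ccomp K \<psi> [\<phi>]"
proof -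
  have "is_vert K h (vdom K h) (vdom K f)" "is_vert K k (vdom K k) (vdom K g)"
    using assms(3,4) by (auto simp: is_vert_def)
  with assms(5) show ?thesis
    by (intro conjunct2[OF assms(1)[unfolded cartesian_iff[OF assms(2)]], rule_format] conjI)
qed

text \<open>Composing with the cartesian cell \<open>\<rho>\<close> is a bijection from test cells
  for \<open>\<psi>\<close> to test cells for the composite, and it matches the factorisations of
  the two. So one universal property carries over to the other.\<close>

lemma cartesian_ccomp_iff:
  assumes \<rho>: "cartesian K \<rho>" "is_cell K \<rho> f' Q R g'"
    and \<psi>: "is_cell K \<psi> f P Q g"
  shows "cartesian K (ccomp K \<rho> [\<psi>]) \<longleftrightarrow> cartesian K \<psi>"
proof -
  let ?c = "ccomp K \<rho> [\<psi>]"
  note c = is_cell_ccomp[OF \<psi> \<rho>(2)]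
  have f: "is_vert K f (vdom K f) (vdom K f')" and g: "is_vert K g (vdom K g) (vdom K g')"
    using is_cell_vert[OF \<psi>] vcod_eq_vdom[OF \<psi> \<rho>(2)] by simp_all
  note f' = is_cell_vert(1)[OF \<rho>(2)] and g' = is_cell_vert(2)[OF \<rho>(2)]
  have dom: "vdom K (vcomp K f' f) = vdom K f" "vdom K (vcomp K g' g) = vdom K g"
    using vcomp_vert[OF f f'] vcomp_vert[OF g g'] by (simp_all add: is_vert_def)
  \<comment> \<open>Test cells for the composite have sides bracketed as \<open>(f' f) h\<close>;
    factoring them through \<open>\<rho>\<close> needs \<open>f' (f h)\<close>.\<close>
  have vassoc: "vcomp K (vcomp K f' f) h = vcomp K f' (vcomp K f h)"
      "vcomp K (vcomp K g' g) k = vcomp K g' (vcomp K g k)"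
    if "is_vert K h (vdom K h) (vdom K f)" "is_vert K k (vdom K k) (vdom K g)" for h k
    using vcomp_assoc[OF that(1) f f'] vcomp_assoc[OF that(2) g g'] by simp_all
  have assoc: "ccomp K \<rho> [ccomp K \<psi> [\<phi>]] = ccomp K ?c [\<phi>]" if "is_cell K \<phi> h H P k" for \<phi> h H k
    using ccomp_single_assoc[OF that \<psi> \<rho>(2)] .
  have uni: "\<exists>!\<xi>. is_cell K \<xi> (vcomp K f h) H Q (vcomp K g k) \<and> \<chi> = ccomp K \<rho> [\<xi>]"
    if h: "is_vert K h (vdom K h) (vdom K f)" and k: "is_vert K k (vdom K k) (vdom K g)"
      and \<chi>: "is_cell K \<chi> (vcomp K (vcomp K f' f) h) H R (vcomp K (vcomp K g' g) k)" for \<chi> H h k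
  proof (rule cartesian_factor[OF \<rho>])
    show "is_vert K (vcomp K f h) (vdom K h) (vdom K f')"
      "is_vert K (vcomp K g k) (vdom K k) (vdom K g')"
      using vcomp_vert[OF h f] vcomp_vert[OF k g] .
    show "is_cell K \<chi> (vcomp K f' (vcomp K f h)) H R (vcomp K g' (vcomp K g k))"
      using \<chi> vassoc[OF h k] by simp
  qed
  have comp\<rho>: "is_cell K (ccomp K \<rho> [\<xi>])
      (vcomp K (vcomp K f' f) h) H R (vcomp K (vcomp K g' g) k)"
    if h: "is_vert K h (vdom K h) (vdom K f)" and k: "is_vert K k (vdom K k) (vdom K g)"
      and \<xi>: "is_cell K \<xi> (vcomp K f h) H Q (vcomp K g k)" for \<xi> H h k
    using is_cell_ccomp[OF \<xi> \<rho>(2)] vassoc[OF h k] by simp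
  \<comment> \<open>The same cells \<open>\<phi>\<close> occur on both sides: by \<open>uni\<close>,
    \<open>\<rho>\<close> can be cancelled from \<open>\<rho> \<circ> \<xi> = \<rho> \<circ> (\<psi>
    \<circ> \<phi>)\<close>.\<close>
  have factor_iff: "(\<exists>!\<phi>. is_cell K \<phi> h H P k \<and> \<xi> = ccomp K \<psi> [\<phi>]) \<longleftrightarrow>
      (\<exists>!\<phi>. is_cell K \<phi> h H P k \<and> ccomp K \<rho> [\<xi>] = ccomp K ?c [\<phi>])"
    if h: "is_vert K h (vdom K h) (vdom K f)" and k: "is_vert K k (vdom K k) (vdom K g)"
      and \<xi>: "is_cell K \<xi> (vcomp K f h) H Q (vcomp K g k)" for \<xi> H h k
  proof -
    have "\<xi> = ccomp K \<psi> [\<phi>] \<longleftrightarrow> ccomp K \<rho> [\<xi>] = ccomp K ?c [\<phi>]" if "is_cell K \<phi> h H P k" for \<phi>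
      using uni[OF h k comp\<rho>[OF h k \<xi>]] \<xi> is_cell_ccomp[OF that \<psi>] assoc[OF that] by metis
    then show ?thesis
      by (simp cong: conj_cong)
  qed
  show ?thesis
  proof
    assume "cartesian K ?c"
    with factor_iff comp\<rho> show "cartesian K \<psi>"
      unfolding cartesian_iff[OF c] cartesian_iff[OF \<psi>] dom by simp
  next
    assume cart: "cartesian K \<psi>"
    have "\<exists>!\<phi>. is_cell K \<phi> h H P k \<and> \<chi> = ccomp K ?c [\<phi>]"
      if h: "is_vert K h (vdom K h) (vdom K f)" and k: "is_vert K k (vdom K k) (vdom K g)"
        and \<chi>: "is_cell K \<chi> (vcomp K (vcomp K f' f) h) H R (vcomp K (vcomp K g' g) k)" for \<chi> H h k
    proof -
      \<comment> \<open>Surjectivity of the bijection: every test cell for the composite comes from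
        one for \<open>\<psi>\<close>.\<close>
      obtain \<xi> where \<xi>: "is_cell K \<xi> (vcomp K f h) H Q (vcomp K g k)" "\<chi> = ccomp K \<rho> [\<xi>]"
        using uni[OF h k \<chi>] by (auto elim: ex1E)
      show ?thesis
        using factor_iff[OF h k \<xi>(1)] cartesian_factor[OF cart \<psi> h k \<xi>(1)] \<xi>(2) by simp
    qed
    with cart show "cartesian K ?c"
      unfolding cartesian_iff[OF c] cartesian_iff[OF \<psi>] dom by simp
  qed
qed

text \<open>A factorisation through \<open>\<rho> \<circ> \<psi>\<close> becomes one through
  \<open>\<rho>\<close> after composing with \<open>\<psi>\<close>. For uniqueness any competitor
  must itself factor through \<open>\<psi>\<close>; the identity sides of \<open>\<psi>\<close>
  allow this, since they put no constraint on \<open>h\<close> and \<open>k\<close>.\<close>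

lemma cartesian_of_ccomp:
  assumes \<psi>: "cartesian K \<psi>" "is_cell K \<psi> (vid K A) P Q (vid K B)"
    and ob: "A \<in> Ob K" "B \<in> Ob K"
    and \<rho>: "is_cell K \<rho> f Q R g" "path_length Q \<le> 1"
    and c: "cartesian K (ccomp K \<rho> [\<psi>])"
  shows "cartesian K \<rho>"
  unfolding cartesian_iff[OF \<rho>(1)]
proof (intro conjI allI impI; (elim conjE)?)
  note vA = vid_vert[OF ob(1)] and vB = vid_vert[OF ob(2)]
  have dom: "vdom K (vid K A) = A" "vdom K (vid K B) = B" "vdom K f = A" "vdom K g = B"
    using vcod_eq_vdom[OF \<psi>(2) \<rho>(1)] vA vB by (auto simp: is_vert_def)
  have "vcomp K f (vid K A) = f" "vcomp K g (vid K B) = g"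
    using vcomp_vid_right is_cell_vert[OF \<rho>(1)] dom by metis+
  then have cc: "is_cell K (ccomp K \<rho> [\<psi>]) f P R g"
    using is_cell_ccomp[OF \<psi>(2) \<rho>(1)] by simp
  fix \<chi> H h k
  assume h: "is_vert K h (vdom K h) (vdom K f)" and k: "is_vert K k (vdom K k) (vdom K g)"
    and \<chi>: "is_cell K \<chi> (vcomp K f h) H R (vcomp K g k)"
  have idhk: "vcomp K (vid K A) h = h" "vcomp K (vid K B) k = k"
    using vcomp_vid_left h k dom by metis+
  obtain \<phi> where \<phi>: "is_cell K \<phi> h H P k" "\<chi> = ccomp K (ccomp K \<rho> [\<psi>]) [\<phi>]"
    and \<phi>_unique: "\<And>\<phi>'. is_cell K \<phi>' h H P k \<Longrightarrow> \<chi> = ccomp K (ccomp K \<rho> [\<psi>]) [\<phi>'] \<Longrightarrow> \<phi>' = \<phi>"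
    using cartesian_factor[OF c cc h k \<chi>] by blast
  show "\<exists>!\<phi>. is_cell K \<phi> h H Q k \<and> \<chi> = ccomp K \<rho> [\<phi>]"
  proof (rule ex1I[of _ "ccomp K \<psi> [\<phi>]"])
    show "is_cell K (ccomp K \<psi> [\<phi>]) h H Q k \<and> \<chi> = ccomp K \<rho> [ccomp K \<psi> [\<phi>]]"
      using is_cell_ccomp[OF \<phi>(1) \<psi>(2)] ccomp_single_assoc[OF \<phi>(1) \<psi>(2) \<rho>(1)] \<phi>(2) idhk by simp
  next
    fix \<xi>
    assume \<xi>: "is_cell K \<xi> h H Q k \<and> \<chi> = ccomp K \<rho> [\<xi>]"
    \<comment> \<open>The sides of \<open>\<xi>\<close> read as \<open>id \<circ> h\<close> and
      \<open>id \<circ> k\<close>, so \<open>\<xi>\<close> is a test cell for \<open>\<psi>\<close>.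
      Its factor also factors \<open>\<chi>\<close> through the composite, hence is
      \<open>\<phi>\<close>.\<close>
    then obtain \<phi>' where \<phi>': "is_cell K \<phi>' h H P k" "\<xi> = ccomp K \<psi> [\<phi>']"
      using cartesian_factor[OF \<psi>, of h "vdom K h" k "vdom K k" \<xi> H] h k dom idhk by auto
    then have "\<phi>' = \<phi>"
      using \<phi>_unique ccomp_single_assoc[OF \<phi>'(1) \<psi>(2) \<rho>(1)] \<xi> by simp
    then show "\<xi> = ccomp K \<psi> [\<phi>]"
      using \<phi>'(2) by simp
  qed
\<comment> \<open>The goal left over is the length bound on the horizontal source \<open>Q\<close>
  of \<open>\<rho>\<close>.\<close>
qed (use \<rho>(2) in simp)

text \<open>When both cells have sides \<open>h\<close>, writing \<open>h\<close> as
  \<open>h \<circ> id\<close> makes the factor horizontal. This yields \<open>id'\<close> as well as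
  the cell exhibiting the unit of \<open>C\<close>.\<close>

lemma cartesian_horizontal_factor:
  assumes "cartesian K \<psi>" "is_cell K \<psi> h P Q h" "is_vert K h C E" "is_cell K \<chi> h H Q h"
  shows "\<exists>!\<phi>. is_cell K \<phi> (vid K C) H P (vid K C) \<and> \<chi> = ccomp K \<psi> [\<phi>]"
proof (rule cartesian_factor[OF assms(1,2)])
  have "vdom K h = C" "C \<in> Ob K"
    using assms(3) vert_ob by (auto simp: is_vert_def)
  then show "is_vert K (vid K C) C (vdom K h)" "is_vert K (vid K C) C (vdom K h)"
    using vid_vert by simp_all
  show "is_cell K \<chi> (vcomp K h (vid K C)) H Q (vcomp K h (vid K C))"
    using assms(3,4) vcomp_vid_right by metis
qed

lemma full_and_faithful_iff:
  assumes "is_vert K h C E"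
  shows "full_and_faithful K h \<longleftrightarrow> cartesian K (vid_cell K h)"
  using assms by (simp add: full_and_faithful_def is_vert_def)

end

lemma (in augmented_virtual_equipment) full_and_faithful_reflects_unital:
  assumes h: "is_vert K h C E" "full_and_faithful K h" and E: "unital K E"
  shows "unital K C"
proof -
  have ob: "C \<in> Ob K" "E \<in> Ob K"
    using h(1) vert_ob by (auto simp: is_vert_def)
  have dom: "vdom K h = C" "vdom K (vid K C) = C" "vdom K (vid K E) = E"
    using h(1) vid_vert ob by (auto simp: is_vert_def)
  obtain I \<epsilon> where \<epsilon>: "is_cell K \<epsilon> (vid K E) (E, [I]) (E, []) (vid K E)" "cartesian K \<epsilon>"
    using E dom by (auto simp: unital_def is_horizontal_unit_def is_restriction_def)
  \<comment> \<open>The endpoints of \<open>I\<close> are read off from the typing of the horizontal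
    source of \<open>\<epsilon>\<close>; they permit restricting \<open>I\<close> along
    \<open>h\<close> on both sides.\<close>
  then have "is_hor K I E E"
    using is_cell_path(1)[OF \<epsilon>(1)] dom by (auto simp: is_path_def is_hor_def)
  then obtain J \<rho> where \<rho>: "is_cell K \<rho> h (C, [J]) (E, [I]) h" "cartesian K \<rho>"
    using unary_restrictions[OF _ h(1) h(1)] dom(1) unfolding is_restriction_def by metis
  \<comment> \<open>Pasting the restriction \<open>I(h, h)\<close> onto the unit cell of
    \<open>E\<close> exhibits \<open>J\<close> as the nullary restriction
    \<open>E(h, h)\<close>.\<close>
  let ?\<chi> = "ccomp K \<epsilon> [\<rho>]"
  have \<chi>: "is_cell K ?\<chi> h (C, [J]) (E, []) h"
    using is_cell_ccomp[OF \<rho>(1) \<epsilon>(1)] vcomp_vid_left[OF h(1)] by simp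
  have \<chi>_cart: "cartesian K ?\<chi>"
    using cartesian_ccomp_iff[OF \<epsilon>(2,1) \<rho>(1)] \<rho>(2) by simp
  have id_cart: "cartesian K (vid_cell K h)"
    using h full_and_faithful_iff by simp
  obtain \<psi> where \<psi>: "is_cell K \<psi> (vid K C) (C, [J]) (C, []) (vid K C)"
    "?\<chi> = ccomp K (vid_cell K h) [\<psi>]"
    using cartesian_horizontal_factor[OF id_cart vid_cell[OF h(1)] h(1) \<chi>] by blast
  \<comment> \<open>Cancelling the cartesian cell \<open>id\<^sub>h\<close> leaves \<open>J\<close>
    as the horizontal unit of \<open>C\<close>.\<close>
  then have "cartesian K \<psi>"
    using cartesian_ccomp_iff[OF id_cart vid_cell[OF h(1)] \<psi>(1)] \<chi>_cart by simp
  then show ?thesis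
    using \<psi>(1) ob dom by (auto simp: unital_def is_horizontal_unit_def is_restriction_def)
qed

theorem lemma5p14:
  fixes K :: "('o, 'v, 'h, 'c) avdc_data"
  assumes "augmented_virtual_double_category K"
  shows
    "(\<forall>C E h J \<chi> \<psi>.
        is_vert K h C E \<and> is_hor K J C C \<and>
        is_cell K \<chi> h (C, [J]) (E, []) h \<and>
        is_cell K \<psi> (vid K C) (C, [J]) (C, []) (vid K C) \<and>
        \<chi> = ccomp K (vid_cell K h) [\<psi>] \<longrightarrow>
        (cartesian K \<chi> \<and> cartesian K \<psi> \<longrightarrow> full_and_faithful K h) \<and>
        (cartesian K \<chi> \<and> full_and_faithful K h \<longrightarrow> cartesian K \<psi>) \<and>
        (cartesian K \<psi> \<and> full_and_faithful K h \<longrightarrow> cartesian K \<chi>) \<and>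
        (cartesian K \<chi> \<longrightarrow>
          (\<exists>!id'. is_cell K id' (vid K C) (C, []) (C, [J]) (vid K C) \<and>
             vid_cell K h = ccomp K \<chi> [id']) \<and>
          (\<forall>id'. is_cell K id' (vid K C) (C, []) (C, [J]) (vid K C) \<and>
             vid_cell K h = ccomp K \<chi> [id'] \<longrightarrow>
             (cartesian K \<psi> \<longleftrightarrow> cartesian K id')))) \<and>
     (augmented_virtual_equipment K \<longrightarrow>
       (\<forall>C E h. is_vert K h C E \<and> full_and_faithful K h \<and> unital K E \<longrightarrow> unital K C))"
proof (intro conjI allI impI; (elim conjE)?)
  interpret augmented_virtual_double_category K
    by fact
  fix C E h J \<chi> \<psi>
  assume h: "is_vert K h C E"
    and \<chi>: "is_cell K \<chi> h (C, [J]) (E, []) h"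
    and \<psi>: "is_cell K \<psi> (vid K C) (C, [J]) (C, []) (vid K C)"
    and \<chi>\<psi>: "\<chi> = ccomp K (vid_cell K h) [\<psi>]"
  note idh = vid_cell[OF h] and ff = full_and_faithful_iff[OF h]
  have C: "C \<in> Ob K"
    using h vert_ob by (auto simp: is_vert_def)
  \<comment> \<open>Here \<open>\<psi>\<close> is the inner factor with identity sides and
    \<open>id\<^sub>h\<close> the outer one, with the empty path at \<open>C\<close> between
    them.\<close>
  show ab_c: "full_and_faithful K h" if "cartesian K \<chi>" "cartesian K \<psi>"
    using cartesian_of_ccomp[OF that(2) \<psi> C C idh] that(1) \<chi>\<psi> ff by simp
  have c_ab: "cartesian K \<chi> \<longleftrightarrow> cartesian K \<psi>" if "full_and_faithful K h"
    using cartesian_ccomp_iff[OF _ idh \<psi>] that \<chi>\<psi> ff by simp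
  show "cartesian K \<psi>" if "cartesian K \<chi>" "full_and_faithful K h"
    using c_ab that by simp
  show "cartesian K \<chi>" if "cartesian K \<psi>" "full_and_faithful K h"
    using c_ab that by simp
  show "\<exists>!id'. is_cell K id' (vid K C) (C, []) (C, [J]) (vid K C) \<and> vid_cell K h = ccomp K \<chi> [id']"
    if "cartesian K \<chi>"
    using cartesian_horizontal_factor[OF that \<chi> h idh] .
  \<comment> \<open>Cancelling \<open>\<chi>\<close> from
    \<open>id\<^sub>h = \<chi> \<circ> id'\<close> turns (b') into (c), and under (a) the
    implications above make (c) equivalent to (b).\<close>
  show "cartesian K \<psi> \<longleftrightarrow> cartesian K id'"
    if a: "cartesian K \<chi>" and id': "is_cell K id' (vid K C) (C, []) (C, [J]) (vid K C)"
      "vid_cell K h = ccomp K \<chi> [id']" for id'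
    using cartesian_ccomp_iff[OF a \<chi> id'(1)] id'(2) ff ab_c c_ab a by auto
next
  fix C E h
  assume "augmented_virtual_equipment K" "is_vert K h C E" "full_and_faithful K h" "unital K E"
  then show "unital K C"
    by (rule augmented_virtual_equipment.full_and_faithful_reflects_unital)
qed

end
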